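(* Every arrow of $\mathrm{Sp}(\mathbf{Rel}_f^c)$ is equal to an expression built from the ten arrows $\Delta, \bot, \nabla, \top, \Lambda, \downarrow, \mathsf{V}, \uparrow, \mathsf{I}, \mathsf{X}$ (defined below) using only composition $;$ and tensor $\otimes$.
   Context: A set with contention ($c$-set) is a pair $(X, \frown_X)$ with $\frown_X \subseteq X\times X$ reflexive and symmetric; it is discrete if $\frown_X$ is the diagonal. A $c$-set morphism $h : X \to Y$ is a function with $h(x) \frown_Y h(x') \Rightarrow x \frown_X x'$. $\mathcal{P}_c X$ is the set of independent subsets $U \subseteq X$ (those with $u \frown_X u' \Rightarrow u = u'$), a $c$-set with $U \frown V$ iff some $u\in U, v\in V$ have $u\frown_X v$. $\mathbf{Rel}_f^c$ is the category of finite $c$-sets whose arrows $X \nrightarrow Y$ are $c$-set morphisms $X \to \mathcal{P}_c Y$, with identity $x \mapsto \{x\}$ and composition $k\circ h = k^\# \circ h$, $k^\#(U) = \bigcup_{u\in U} k(u)$; it has pullbacks. $\mathrm{Sp}(\mathbf{Rel}_f^c)$ has objects the natural numbers $k$ (identified with the discrete $c$-set $\{0,\dots,k-1\}$) and arrows $k \to l$ the isomorphism classes of spans $k \xleftarrow{a} X \xrightarrow{b} l$ in $\mathbf{Rel}_f^c$ with $X$ a finite $c$-set; composition $;$ (diagrammatic order) is by pullback in $\mathbf{Rel}_f^c$. The tensor $\otimes$ sends spans $k_1 \leftarrow X_1 \rightarrow l_1$ and $k_2 \leftarrow X_2 \rightarrow l_2$ to $k_1 + k_2 \leftarrow X_1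 + X_2 \rightarrow l_1 + l_2$, where $X_1 + X_2$ is the disjoint union with $(x,i) \frown (y,j)$ iff $i = j$ and $x \frown_{X_i} y$, the legs act componentwise, and $k_1 + k_2$ is identified with the ordinal $k_1+k_2$. Writing a span as (carrier; left leg; right leg), with $\mathbf{2}$ denoting the $c$-set $\{0,1\}$ with all pairs in contention: $\Delta : 1 \to 2$ is (discrete $\{0\}$; $0 \mapsto \{0\}$; $0 \mapsto \{0,1\}$); $\bot : 1 \to 0$ is (discrete $\{0\}$; $0\mapsto\{0\}$; $0 \mapsto \varnothing$); $\nabla : 2 \to 1$ is (discrete $\{0\}$; $0 \mapsto \{0,1\}$; $0 \mapsto \{0\}$); $\top : 0 \to 1$ is (discrete $\{0\}$; $0\mapsto\varnothing$; $0 \mapsto \{0\}$); $\Lambda : 1 \to 2$ is ($\mathbf{2}$; $i \mapsto \{0\}$; $i \mapsto \{i\}$); $\downarrow : 1 \to 0$ is (empty carrier; empty; empty); $\mathsf{V} : 2 \to 1$ is ($\mathbf{2}$; $i \mapsto \{i\}$; $i \mapsto \{0\}$); $\uparrow : 0 \to 1$ is (empty carrier; empty; empty); $\mathsf{I} : 1 \to 1$ is (discrete $\{0\}$; $0\mapsto\{0\}$; $0\mapsto\{0\}$); $\mathsf{X} : 2 \to 2$ is (discrete $\{0,1\}$; $i \mapsto \{i\}$; $i \mapsto \{1-i\}$). *)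

theory Defs
  imports Main
begin

section \<open>Sets with contention\<close>

record 'a cset =
  carrier :: "'a set"
  con :: "('a \<times> 'a) set"

definition fin_cset :: "'a cset \<Rightarrow> bool" where
  "fin_cset X \<longleftrightarrow> finite (carrier X) \<and> con X \<subseteq> carrier X \<times> carrier X \<and>
     (\<forall>x\<in>carrier X. (x, x) \<in> con X) \<and> (\<forall>x y. (x, y) \<in> con X \<longrightarrow> (y, x) \<in> con X)"

definition discrete :: "'a set \<Rightarrow> 'a cset" where
  "discrete A = \<lparr>carrier = A, con = Id_on A\<rparr>"

definition indiscrete :: "'a set \<Rightarrow> 'a cset" where
  "indiscrete A = \<lparr>carrier = A, con = A \<times> A\<rparr>"

definition ord :: "nat \<Rightarrow> nat cset" where
  "ord k = discrete {..<k}"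

definition cset_mor :: "'a cset \<Rightarrow> 'b cset \<Rightarrow> ('a \<Rightarrow> 'b) \<Rightarrow> bool" where
  "cset_mor X Y h \<longleftrightarrow> (\<forall>x\<in>carrier X. h x \<in> carrier Y) \<and>
     (\<forall>x\<in>carrier X. \<forall>x'\<in>carrier X. (h x, h x') \<in> con Y \<longrightarrow> (x, x') \<in> con X)"

definition independent :: "'a cset \<Rightarrow> 'a set \<Rightarrow> bool" where
  "independent X U \<longleftrightarrow> U \<subseteq> carrier X \<and> (\<forall>u\<in>U. \<forall>u'\<in>U. (u, u') \<in> con X \<longrightarrow> u = u')"

text \<open>The empty set is not in contention with itself, so contention on \<open>Pc X\<close> is
  reflexive on nonempty independent sets only.\<close>

definition Pc :: "'a cset \<Rightarrow> 'a set cset" where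
  "Pc X = \<lparr>carrier = {U. independent X U},
     con = {(U, V). independent X U \<and> independent X V \<and> (\<exists>u\<in>U. \<exists>v\<in>V. (u, v) \<in> con X)}\<rparr>"


section \<open>The category of finite c-sets and relational morphisms\<close>

text \<open>A morphism takes the value \<open>{}\<close> outside the carrier of its domain, so that equality
  of morphisms is equality of HOL functions. Composition preserves this convention.\<close>

definition rel_hom :: "'a cset \<Rightarrow> 'b cset \<Rightarrow> ('a \<Rightarrow> 'b set) set" where
  "rel_hom X Y = {h. cset_mor X (Pc Y) h \<and> (\<forall>x. x \<notin> carrier X \<longrightarrow> h x = {})}"

definition rel_id :: "'a cset \<Rightarrow> 'a \<Rightarrow> 'a set" where
  "rel_id X = (\<lambda>x. if x \<in> carrier X then {x} else {})"

definition sharp :: "('a \<Rightarrow> 'b set) \<Rightarrow> 'a set \<Rightarrow> 'b set" where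
  "sharp k U = (\<Union>u\<in>U. k u)"

definition rel_comp :: "('b \<Rightarrow> 'c set) \<Rightarrow> ('a \<Rightarrow> 'b set) \<Rightarrow> 'a \<Rightarrow> 'c set"  (infixl "\<bullet>" 70) where
  "k \<bullet> h = sharp k \<circ> h"

definition rel_iso :: "'a cset \<Rightarrow> 'b cset \<Rightarrow> ('a \<Rightarrow> 'b set) \<Rightarrow> bool" where
  "rel_iso X Y h \<longleftrightarrow> h \<in> rel_hom X Y \<and>
     (\<exists>h'\<in>rel_hom Y X. h' \<bullet> h = rel_id X \<and> h \<bullet> h' = rel_id Y)"

text \<open>The test objects \<open>W\<close> range over finite c-sets of natural numbers only; every finite
  c-set is isomorphic to one of these.\<close>

definition is_pullback ::
  "nat cset \<Rightarrow> nat cset \<Rightarrow> nat cset \<Rightarrow> (nat \<Rightarrow> nat set) \<Rightarrow> (nat \<Rightarrow> nat set) \<Rightarrow>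
   nat cset \<Rightarrow> (nat \<Rightarrow> nat set) \<Rightarrow> (nat \<Rightarrow> nat set) \<Rightarrow> bool" where
  "is_pullback X Y Z f g P p q \<longleftrightarrow>
     f \<in> rel_hom X Z \<and> g \<in> rel_hom Y Z \<and>
     fin_cset P \<and> p \<in> rel_hom P X \<and> q \<in> rel_hom P Y \<and> f \<bullet> p = g \<bullet> q \<and>
     (\<forall>(W :: nat cset) p' q'. fin_cset W \<and> p' \<in> rel_hom W X \<and> q' \<in> rel_hom W Y \<and> f \<bullet> p' = g \<bullet> q' \<longrightarrow>
        (\<exists>!m. m \<in> rel_hom W P \<and> p \<bullet> m = p' \<and> q \<bullet> m = q'))"


section \<open>Spans\<close>

record 'a cspan =
  src :: nat
  trg :: nat
  apex :: "'a cset"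
  lleg :: "'a \<Rightarrow> nat set"
  rleg :: "'a \<Rightarrow> nat set"

definition is_span :: "'a cspan \<Rightarrow> bool" where
  "is_span S \<longleftrightarrow> fin_cset (apex S) \<and>
     lleg S \<in> rel_hom (apex S) (ord (src S)) \<and> rleg S \<in> rel_hom (apex S) (ord (trg S))"

definition span_iso :: "'a cspan \<Rightarrow> 'b cspan \<Rightarrow> bool" where
  "span_iso S T \<longleftrightarrow> src S = src T \<and> trg S = trg T \<and>
     (\<exists>h. rel_iso (apex S) (apex T) h \<and> lleg T \<bullet> h = lleg S \<and> rleg T \<bullet> h = rleg S)"

text \<open>Isomorphism classes are formed among the spans whose apex is a set of natural numbers.
  The span \<open>S\<close> may live on any type; see \<open>span_class_in_Sp_hom\<close> below.\<close>

definition span_class :: "'a cspan \<Rightarrow> nat cspan set" where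
  "span_class S = {T. is_span T \<and> span_iso S T}"

definition Sp_hom :: "nat \<Rightarrow> nat \<Rightarrow> nat cspan set set" where
  "Sp_hom k l = {span_class S | S :: nat cspan. is_span S \<and> src S = k \<and> trg S = l}"

text \<open>Composition and tensor act on isomorphism classes. The union runs over all
  representatives and, for composition, over all pullbacks; all of these yield the same
  class.\<close>

definition Sp_comp :: "nat cspan set \<Rightarrow> nat cspan set \<Rightarrow> nat cspan set" where
  "Sp_comp F G = \<Union> {span_class \<lparr>src = src S, trg = trg T, apex = P,
                          lleg = lleg S \<bullet> p, rleg = rleg T \<bullet> q\<rparr> | S T P p q.
     S \<in> F \<and> T \<in> G \<and> trg S = src T \<and>
     is_pullback (apex S) (apex T) (ord (trg S)) (rleg S) (lleg T) P p q}"

definition cset_sum :: "'a cset \<Rightarrow> 'b cset \<Rightarrow> ('a + 'b) cset" where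
  "cset_sum X Y = \<lparr>carrier = carrier X <+> carrier Y,
     con = {(Inl x, Inl x') | x x'. (x, x') \<in> con X} \<union> {(Inr y, Inr y') | y y'. (y, y') \<in> con Y}\<rparr>"

text \<open>The sum of ordinals \<open>k + l\<close> is identified with the ordinal \<open>k + l\<close> by shifting the
  second summand by \<open>k\<close>.\<close>

definition leg_sum :: "nat \<Rightarrow> ('a \<Rightarrow> nat set) \<Rightarrow> ('b \<Rightarrow> nat set) \<Rightarrow> 'a + 'b \<Rightarrow> nat set" where
  "leg_sum k a b = case_sum a (\<lambda>y. (+) k ` b y)"

definition span_sum :: "'a cspan \<Rightarrow> 'b cspan \<Rightarrow> ('a + 'b) cspan" where
  "span_sum S T = \<lparr>src = src S + src T, trg = trg S + trg T, apex = cset_sum (apex S) (apex T),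
     lleg = leg_sum (src S) (lleg S) (lleg T), rleg = leg_sum (trg S) (rleg S) (rleg T)\<rparr>"

definition Sp_tensor :: "nat cspan set \<Rightarrow> nat cspan set \<Rightarrow> nat cspan set" where
  "Sp_tensor F G = \<Union> {span_class (span_sum S T) | S T. S \<in> F \<and> T \<in> G}"


section \<open>Expressions\<close>

definition mk_span :: "nat \<Rightarrow> nat \<Rightarrow> nat cset \<Rightarrow> (nat \<Rightarrow> nat set) \<Rightarrow> (nat \<Rightarrow> nat set) \<Rightarrow> nat cspan"
where
  "mk_span k l X a b = \<lparr>src = k, trg = l, apex = X,
     lleg = (\<lambda>x. if x \<in> carrier X then a x else {}),
     rleg = (\<lambda>x. if x \<in> carrier X then b x else {})\<rparr>"

datatype generator =
  Delta | Bot | Nabla | Top | Lambda | Down | Vee | Up | Wire | Twist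

primrec gen_span :: "generator \<Rightarrow> nat cspan" where
  "gen_span Delta  = mk_span 1 2 (discrete {0})      (\<lambda>_. {0})      (\<lambda>_. {0, 1})"
| "gen_span Bot    = mk_span 1 0 (discrete {0})      (\<lambda>_. {0})      (\<lambda>_. {})"
| "gen_span Nabla  = mk_span 2 1 (discrete {0})      (\<lambda>_. {0, 1})   (\<lambda>_. {0})"
| "gen_span Top    = mk_span 0 1 (discrete {0})      (\<lambda>_. {})       (\<lambda>_. {0})"
| "gen_span Lambda = mk_span 1 2 (indiscrete {0, 1}) (\<lambda>_. {0})      (\<lambda>i. {i})"
| "gen_span Down   = mk_span 1 0 (discrete {})       (\<lambda>_. {})       (\<lambda>_. {})"
| "gen_span Vee    = mk_span 2 1 (indiscrete {0, 1}) (\<lambda>i. {i})      (\<lambda>_. {0})"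
| "gen_span Up     = mk_span 0 1 (discrete {})       (\<lambda>_. {})       (\<lambda>_. {})"
| "gen_span Wire   = mk_span 1 1 (discrete {0})      (\<lambda>_. {0})      (\<lambda>_. {0})"
| "gen_span Twist  = mk_span 2 2 (discrete {0, 1})   (\<lambda>i. {i})      (\<lambda>i. {1 - i})"

datatype expr = Gen generator | Seq expr expr | Par expr expr

inductive has_type :: "expr \<Rightarrow> nat \<Rightarrow> nat \<Rightarrow> bool" where
  "has_type (Gen g) (src (gen_span g)) (trg (gen_span g))"
| "has_type e k l \<Longrightarrow> has_type e' l m \<Longrightarrow> has_type (Seq e e') k m"
| "has_type e k l \<Longrightarrow> has_type e' k' l' \<Longrightarrow> has_type (Par e e') (k + k') (l + l')"

primrec sem :: "expr \<Rightarrow> nat cspan set" where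
  "sem (Gen g) = span_class (gen_span g)"
| "sem (Seq e e') = Sp_comp (sem e) (sem e')"
| "sem (Par e e') = Sp_tensor (sem e) (sem e')"


section \<open>Basic facts\<close>

lemma rel_comp_apply: "(k \<bullet> h) x = (\<Union>y\<in>h x. k y)"
  by (simp add: rel_comp_def sharp_def)

lemma rel_homD:
  assumes "h \<in> rel_hom X Y"
  shows "x \<in> carrier X \<Longrightarrow> y \<in> h x \<Longrightarrow> y \<in> carrier Y"
    and "x \<in> carrier X \<Longrightarrow> y \<in> h x \<Longrightarrow> y' \<in> h x \<Longrightarrow> (y, y') \<in> con Y \<Longrightarrow> y = y'"
    and "x \<in> carrier X \<Longrightarrow> x' \<in> carrier X \<Longrightarrow> y \<in> h x \<Longrightarrow> y' \<in> h x' \<Longrightarrow> (y, y') \<in> con Y \<Longrightarrow>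
           (x, x') \<in> con X"
    and "x \<notin> carrier X \<Longrightarrow> h x = {}"
  using assms by (auto simp: rel_hom_def cset_mor_def Pc_def independent_def) blast+

lemma rel_homI:
  assumes "\<And>x y. x \<in> carrier X \<Longrightarrow> y \<in> h x \<Longrightarrow> y \<in> carrier Y"
    and "\<And>x y y'. x \<in> carrier X \<Longrightarrow> y \<in> h x \<Longrightarrow> y' \<in> h x \<Longrightarrow> (y, y') \<in> con Y \<Longrightarrow> y = y'"
    and "\<And>x x' y y'. x \<in> carrier X \<Longrightarrow> x' \<in> carrier X \<Longrightarrow> y \<in> h x \<Longrightarrow> y' \<in> h x' \<Longrightarrow>
           (y, y') \<in> con Y \<Longrightarrow> (x, x') \<in> con X"
    and "\<And>x. x \<notin> carrier X \<Longrightarrow> h x = {}"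
  shows "h \<in> rel_hom X Y"
  using assms unfolding rel_hom_def cset_mor_def Pc_def independent_def by simp blast

lemma rel_id_hom: "rel_id X \<in> rel_hom X X"
  by (rule rel_homI) (auto simp: rel_id_def)

lemma rel_comp_hom:
  assumes h: "h \<in> rel_hom X Y" and k: "k \<in> rel_hom Y Z"
  shows "k \<bullet> h \<in> rel_hom X Z"
proof (rule rel_homI, goal_cases)
  case (1 x y)
  then show ?case using rel_homD(1)[OF h] rel_homD(1)[OF k] by (auto simp: rel_comp_apply)
next
  case (2 x y y')
  then obtain u u' where u: "u \<in> h x" "y \<in> k u" "u' \<in> h x" "y' \<in> k u'"
    by (auto simp: rel_comp_apply)
  then have uY: "u \<in> carrier Y" "u' \<in> carrier Y" using rel_homD(1)[OF h] 2 by auto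
  have "(u, u') \<in> con Y" using rel_homD(3)[OF k uY] u 2 by blast
  then have "u = u'" using rel_homD(2)[OF h] u 2 by blast
  then show ?case using rel_homD(2)[OF k uY(1)] u 2 by blast
next
  case (3 x x' y y')
  then obtain u u' where u: "u \<in> h x" "y \<in> k u" "u' \<in> h x'" "y' \<in> k u'"
    by (auto simp: rel_comp_apply)
  then have uY: "u \<in> carrier Y" "u' \<in> carrier Y" using rel_homD(1)[OF h] 3 by auto
  have "(u, u') \<in> con Y" using rel_homD(3)[OF k uY] u 3 by blast
  then show ?case using rel_homD(3)[OF h] u 3 by blast
next
  case (4 x)
  then show ?case using rel_homD(4)[OF h] by (simp add: rel_comp_apply)
qed

lemma rel_comp_assoc: "(l \<bullet> k) \<bullet> h = l \<bullet> (k \<bullet> h)"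
  by (auto simp: fun_eq_iff rel_comp_apply)

lemma rel_comp_id:
  assumes "h \<in> rel_hom X Y"
  shows "h \<bullet> rel_id X = h" "rel_id Y \<bullet> h = h"
proof -
  show "h \<bullet> rel_id X = h"
    using rel_homD(4)[OF assms] by (auto simp: fun_eq_iff rel_comp_apply rel_id_def)
  have "(rel_id Y \<bullet> h) x = h x" for x
    using rel_homD(1,4)[OF assms] by (cases "x \<in> carrier X") (auto simp: rel_comp_apply rel_id_def)
  then show "rel_id Y \<bullet> h = h" by auto
qed

lemma span_iso_sym: "span_iso S T \<Longrightarrow> is_span S \<Longrightarrow> is_span T \<Longrightarrow> span_iso T S"
  unfolding span_iso_def rel_iso_def is_span_def
  by (metis rel_comp_assoc rel_comp_id(1))

lemma span_iso_trans:
  assumes "span_iso S T" "span_iso T U"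
  shows "span_iso S U"
proof -
  obtain h h' where h: "h \<in> rel_hom (apex S) (apex T)" "h' \<in> rel_hom (apex T) (apex S)"
    "h' \<bullet> h = rel_id (apex S)" "h \<bullet> h' = rel_id (apex T)"
    "lleg T \<bullet> h = lleg S" "rleg T \<bullet> h = rleg S"
    using assms(1) unfolding span_iso_def rel_iso_def by blast
  obtain k k' where k: "k \<in> rel_hom (apex T) (apex U)" "k' \<in> rel_hom (apex U) (apex T)"
    "k' \<bullet> k = rel_id (apex T)" "k \<bullet> k' = rel_id (apex U)"
    "lleg U \<bullet> k = lleg T" "rleg U \<bullet> k = rleg T"
    using assms(2) unfolding span_iso_def rel_iso_def by blast
  have "(h' \<bullet> k') \<bullet> (k \<bullet> h) = h' \<bullet> ((k' \<bullet> k) \<bullet> h)" by (simp only: rel_comp_assoc)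
  then have 1: "(h' \<bullet> k') \<bullet> (k \<bullet> h) = rel_id (apex S)"
    by (simp only: k(3) rel_comp_id(2)[OF h(1)] h(3))
  have "(k \<bullet> h) \<bullet> (h' \<bullet> k') = k \<bullet> ((h \<bullet> h') \<bullet> k')" by (simp only: rel_comp_assoc)
  then have 2: "(k \<bullet> h) \<bullet> (h' \<bullet> k') = rel_id (apex U)"
    by (simp only: h(4) rel_comp_id(2)[OF k(2)] k(4))
  have "lleg U \<bullet> (k \<bullet> h) = lleg S" "rleg U \<bullet> (k \<bullet> h) = rleg S"
    by (simp_all only: rel_comp_assoc[symmetric] k(5,6) h(5,6))
  then show ?thesis
    using 1 2 rel_comp_hom[OF h(1) k(1)] rel_comp_hom[OF k(2) h(2)] assms
    unfolding span_iso_def rel_iso_def by auto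
qed

lemma span_nat_representative:
  fixes S :: "'a cspan"
  assumes S: "is_span S"
  shows "\<exists>T :: nat cspan. is_span T \<and> span_iso S T"
proof -
  define X where "X = apex S"
  have X: "finite (carrier X)" "con X \<subseteq> carrier X \<times> carrier X"
    "\<And>x. x \<in> carrier X \<Longrightarrow> (x, x) \<in> con X" "\<And>x y. (x, y) \<in> con X \<Longrightarrow> (y, x) \<in> con X"
    and legs: "lleg S \<in> rel_hom X (ord (src S))" "rleg S \<in> rel_hom X (ord (trg S))"
    using S by (auto simp: is_span_def fin_cset_def X_def)
  obtain e :: "'a \<Rightarrow> nat" where e: "inj_on e (carrier X)"
    using finite_imp_inj_to_nat_seg[OF X(1)] by blast
  define Y where "Y = \<lparr>carrier = e ` carrier X, con = {(e x, e y) | x y. (x, y) \<in> con X}\<rparr>"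
  define h where "h = (\<lambda>x. if x \<in> carrier X then {e x} else {})"
  define h' where "h' = (\<lambda>n. {x \<in> carrier X. e x = n})"
  have con_Y: "(e x, e y) \<in> con Y \<longleftrightarrow> (x, y) \<in> con X"
    if "x \<in> carrier X" "y \<in> carrier X" for x y
  proof
    assume "(e x, e y) \<in> con Y"
    then obtain x' y' where "e x = e x'" "e y = e y'" "(x', y') \<in> con X"
      by (auto simp: Y_def)
    then show "(x, y) \<in> con X"
      using that X(2) by (metis inj_onD[OF e] mem_Sigma_iff subsetD)
  qed (auto simp: Y_def)
  have Y: "fin_cset Y"
    using X unfolding fin_cset_def Y_def by simp blast
  have h: "h \<in> rel_hom X Y"
    by (rule rel_homI) (auto simp: h_def con_Y Y_def[THEN arg_cong[where f = carrier]])
  have h': "h' \<in> rel_hom Y X"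
    by (rule rel_homI)
       (auto simp: h'_def con_Y Y_def[THEN arg_cong[where f = carrier]] dest: inj_onD[OF e])
  have hh': "h' \<bullet> h = rel_id X" "h \<bullet> h' = rel_id Y"
    by (auto simp: fun_eq_iff rel_comp_apply h_def h'_def rel_id_def Y_def dest: inj_onD[OF e])
  define T where "T = \<lparr>src = src S, trg = trg S, apex = Y, lleg = lleg S \<bullet> h', rleg = rleg S \<bullet> h'\<rparr>"
  have "is_span T"
    using Y rel_comp_hom[OF h' legs(1)] rel_comp_hom[OF h' legs(2)]
    by (simp add: is_span_def T_def)
  moreover have "span_iso S T"
    unfolding span_iso_def rel_iso_def
    using h h' hh' legs
    by (auto simp: T_def X_def[symmetric] rel_comp_assoc rel_comp_id intro!: exI[of _ h])
  ultimately show ?thesis by blast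
qed

lemma span_class_in_Sp_hom:
  fixes S :: "'a cspan"
  assumes S: "is_span S"
  shows "span_class S \<in> Sp_hom (src S) (trg S)"
proof -
  obtain T :: "nat cspan" where T: "is_span T" "span_iso S T"
    using span_nat_representative[OF S] by blast
  then have "span_class S = span_class T"
    unfolding span_class_def
    using span_iso_trans[OF T(2)] span_iso_trans[OF span_iso_sym[OF T(2) S T(1)]] by blast
  then show ?thesis using T unfolding Sp_hom_def span_iso_def by auto
qed

lemma gen_span_is_span: "is_span (gen_span g)"
  by (cases g)
     (auto simp: is_span_def fin_cset_def mk_span_def discrete_def indiscrete_def ord_def
       intro!: rel_homI split: if_splits)

lemma span_sum_is_span: "is_span S \<Longrightarrow> is_span T \<Longrightarrow> is_span (span_sum S T)"
proof -
  assume "is_span S" "is_span T"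
  then have fin: "fin_cset (apex S)" "fin_cset (apex T)"
    and legs: "lleg S \<in> rel_hom (apex S) (ord (src S))" "rleg S \<in> rel_hom (apex S) (ord (trg S))"
      "lleg T \<in> rel_hom (apex T) (ord (src T))" "rleg T \<in> rel_hom (apex T) (ord (trg T))"
    by (auto simp: is_span_def)
  have "leg_sum k a b \<in> rel_hom (cset_sum X Y) (ord (k + l))"
    if a: "a \<in> rel_hom X (ord k)" and b: "b \<in> rel_hom Y (ord l)"
    for k l a b and X :: "'a cset" and Y :: "'b cset"
  proof (rule rel_homI, goal_cases)
    case (1 x y)
    then show ?case using rel_homD(1)[OF a] rel_homD(1)[OF b]
      by (cases x) (auto simp: leg_sum_def cset_sum_def ord_def discrete_def intro: trans_less_add1)
  next
    case (2 x y y')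
    then show ?case by (auto simp: ord_def discrete_def)
  next
    case (3 x x' y y')
    then have y: "y = y'" by (auto simp: ord_def discrete_def)
    have lt: "y < k" if "x \<in> carrier X" "y \<in> a x" for x y
      using rel_homD(1)[OF a that] by (simp add: ord_def discrete_def)
    have con_a: "(u, u') \<in> con X"
      if "u \<in> carrier X" "u' \<in> carrier X" "z \<in> a u" "z \<in> a u'" for u u' z
      using rel_homD(3)[OF a that] lt[OF that(1,3)] by (auto simp: ord_def discrete_def)
    have con_b: "(u, u') \<in> con Y"
      if "u \<in> carrier Y" "u' \<in> carrier Y" "z \<in> b u" "z \<in> b u'" for u u' z
      using rel_homD(3)[OF b that] rel_homD(1)[OF b that(1,3)] by (auto simp: ord_def discrete_def)
    show ?case using 3(1-4) y con_a con_b
      by (cases x; cases x') (auto simp: leg_sum_def cset_sum_def dest: lt)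
  next
    case (4 x)
    then show ?case using rel_homD(4)[OF a] rel_homD(4)[OF b]
      by (cases x) (auto simp: leg_sum_def cset_sum_def)
  qed
  moreover have "fin_cset (cset_sum (apex S) (apex T))"
    using fin by (auto simp: fin_cset_def cset_sum_def)
  ultimately show ?thesis using legs by (simp add: is_span_def span_sum_def)
qed

end

theory Submission
  imports Defs
begin

text \<open>Enumerating the apex \<open>X\<close> of a span as \<open>{..<n}\<close> factors it through the ordinal \<open>n\<close> as
  \<open>k \<leftarrow> X \<rightarrow> n\<close> followed by \<open>n \<leftarrow> X \<rightarrow> l\<close>, where both inner legs are \<open>x \<mapsto> {x}\<close>; pullbacks along such a
  leg have a simple explicit form. The second factor is the mirror image of a span of the first
  kind, and the set of generators is closed under mirroring. A span \<open>k \<leftarrow> X \<rightarrow> n\<close> with right leg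
  \<open>x \<mapsto> {x}\<close> is assembled event by event: a wire used by a new event is copied with \<open>\<Lambda>\<close>, which puts
  the new event in contention with the other users of the wire, and the copies are merged with
  \<open>\<nabla>\<close>. Contention not forced by a shared wire comes from auxiliary wires that are closed with \<open>\<top>\<close>.\<close>

section \<open>Isomorphic spans and duality\<close>

lemma is_spanD:
  assumes "is_span S"
  shows "fin_cset (apex S)" "lleg S \<in> rel_hom (apex S) (ord (src S))"
    "rleg S \<in> rel_hom (apex S) (ord (trg S))"
  using assms by (auto simp: is_span_def)

lemma span_isoE:
  assumes "span_iso S T" "is_span S"
  obtains h h' where "h \<in> rel_hom (apex S) (apex T)" "h' \<in> rel_hom (apex T) (apex S)"
    "h' \<bullet> h = rel_id (apex S)" "h \<bullet> h' = rel_id (apex T)"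
    "lleg T \<bullet> h = lleg S" "rleg T \<bullet> h = rleg S"
    using assms unfolding span_iso_def rel_iso_def by blast

lemma span_iso_refl: "is_span S \<Longrightarrow> span_iso S S"
  unfolding span_iso_def rel_iso_def
  by (auto simp: rel_comp_id rel_id_hom is_span_def intro!: exI[of _ "rel_id (apex S)"]
      bexI[of _ "rel_id (apex S)"] rel_comp_id[OF rel_id_hom])

lemma span_class_cong:
  assumes "is_span S" "is_span T" "span_iso S T"
  shows "span_class S = span_class T"
  unfolding span_class_def
  using span_iso_trans[OF assms(3)] span_iso_trans[OF span_iso_sym[OF assms(3,1,2)]] by blast

text \<open>Isomorphisms of apexes are relational. A bijection enters as
  \<open>x \<mapsto> {f x}\<close> with the fibre map as its inverse; both are morphisms because
  \<open>f\<close> preserves and reflects contention.\<close>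

lemma span_iso_bij_betw:
  assumes S: "is_span S" and T: "is_span T" and eq: "src S = src T" "trg S = trg T"
    and f: "bij_betw f (carrier (apex S)) (carrier (apex T))"
    and con: "\<And>x y. x \<in> carrier (apex S) \<Longrightarrow> y \<in> carrier (apex S) \<Longrightarrow>
      (f x, f y) \<in> con (apex T) \<longleftrightarrow> (x, y) \<in> con (apex S)"
    and legs: "\<And>x. x \<in> carrier (apex S) \<Longrightarrow> lleg T (f x) = lleg S x"
      "\<And>x. x \<in> carrier (apex S) \<Longrightarrow> rleg T (f x) = rleg S x"
  shows "span_iso S T"
proof -
  define h where "h = (\<lambda>x. if x \<in> carrier (apex S) then {f x} else {})"
  define h' where "h' = (\<lambda>y. {x \<in> carrier (apex S). f x = y})"
  have inj: "inj_on f (carrier (apex S))" and im: "f ` carrier (apex S) = carrier (apex T)"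
    using f by (auto simp: bij_betw_def)
  have h: "h \<in> rel_hom (apex S) (apex T)"
    using im con by (intro rel_homI) (auto simp: h_def)
  have h': "h' \<in> rel_hom (apex T) (apex S)"
    using im con by (intro rel_homI) (auto simp: h'_def dest: inj_onD[OF inj])
  have "h' \<bullet> h = rel_id (apex S)"
    by (auto simp: fun_eq_iff rel_comp_apply h_def h'_def rel_id_def dest: inj_onD[OF inj])
  moreover have "h \<bullet> h' = rel_id (apex T)"
    by (auto simp: fun_eq_iff rel_comp_apply h_def h'_def rel_id_def im[symmetric])
  moreover have "lleg T \<bullet> h = lleg S" "rleg T \<bullet> h = rleg S"
    using legs rel_homD(4)[OF is_spanD(2)[OF S]] rel_homD(4)[OF is_spanD(3)[OF S]]
    by (auto simp: fun_eq_iff rel_comp_apply h_def)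
  ultimately show ?thesis
    using h h' eq unfolding span_iso_def rel_iso_def by blast
qed

section \<open>Mirror images of spans\<close>

definition dagger :: "'a cspan \<Rightarrow> 'a cspan" where
  "dagger S = \<lparr>src = trg S, trg = src S, apex = apex S, lleg = rleg S, rleg = lleg S\<rparr>"

lemma dagger_simps [simp]:
  "src (dagger S) = trg S" "trg (dagger S) = src S" "apex (dagger S) = apex S"
  "lleg (dagger S) = rleg S" "rleg (dagger S) = lleg S" "dagger (dagger S) = S"
  by (simp_all add: dagger_def)

lemma is_span_dagger [simp]: "is_span (dagger S) \<longleftrightarrow> is_span S"
  by (auto simp: is_span_def)

lemma span_iso_dagger [simp]: "span_iso (dagger S) (dagger T) \<longleftrightarrow> span_iso S T"
  by (auto simp: span_iso_def)

lemma dagger_span_sum: "dagger (span_sum S T) = span_sum (dagger S) (dagger T)"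
  by (simp add: dagger_def span_sum_def)


section \<open>Composition and tensor of isomorphism classes\<close>

lemma is_pullbackD:
  assumes "is_pullback X Y Z f g P p q"
  shows "f \<in> rel_hom X Z" "g \<in> rel_hom Y Z" "fin_cset P" "p \<in> rel_hom P X" "q \<in> rel_hom P Y"
    "f \<bullet> p = g \<bullet> q"
  using assms by (auto simp: is_pullback_def)

lemma pullback_factor:
  fixes W :: "nat cset"
  assumes "is_pullback X Y Z f g P p q" "fin_cset W" "p' \<in> rel_hom W X" "q' \<in> rel_hom W Y"
    "f \<bullet> p' = g \<bullet> q'"
  obtains m where "m \<in> rel_hom W P" "p \<bullet> m = p'" "q \<bullet> m = q'"
  using assms unfolding is_pullback_def by blast

text \<open>Both \<open>m\<close> and the identity factor the cone \<open>(p, q)\<close> through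
  itself. This makes comparison maps between pullbacks mutually inverse.\<close>

lemma pullback_endo_id:
  assumes pb: "is_pullback X Y Z f g P p q" and m: "m \<in> rel_hom P P" "p \<bullet> m = p" "q \<bullet> m = q"
  shows "m = rel_id P"
proof -
  have "\<exists>!m. m \<in> rel_hom P P \<and> p \<bullet> m = p \<and> q \<bullet> m = q"
    using pb unfolding is_pullback_def by blast
  moreover have "rel_id P \<in> rel_hom P P \<and> p \<bullet> rel_id P = p \<and> q \<bullet> rel_id P = q"
    using rel_id_hom rel_comp_id(1)[OF is_pullbackD(4)[OF pb]]
      rel_comp_id(1)[OF is_pullbackD(5)[OF pb]] by auto
  ultimately show ?thesis using m by blast
qed

lemma is_pullback_sym:
  assumes "is_pullback X Y Z f g P p q"
  shows "is_pullback Y X Z g f P q p"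
  unfolding is_pullback_def
proof (intro conjI allI impI)
  fix W :: "nat cset" and p' q'
  assume "fin_cset W \<and> p' \<in> rel_hom W Y \<and> q' \<in> rel_hom W X \<and> g \<bullet> p' = f \<bullet> q'"
  then have "\<exists>!m. m \<in> rel_hom W P \<and> p \<bullet> m = q' \<and> q \<bullet> m = p'"
    using assms unfolding is_pullback_def by metis
  then show "\<exists>!m. m \<in> rel_hom W P \<and> q \<bullet> m = p' \<and> p \<bullet> m = q'"
    by (simp only: conj_commute[of "q \<bullet> _ = p'"])
qed (use is_pullbackD[OF assms] in auto)

text \<open>The pullback is an argument because composition of classes ranges over all pullbacks; no
  canonical one is chosen.\<close>

definition span_comp ::
  "nat cspan \<Rightarrow> nat cspan \<Rightarrow> nat cset \<Rightarrow> (nat \<Rightarrow> nat set) \<Rightarrow> (nat \<Rightarrow> nat set) \<Rightarrow> nat cspan"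
where
  "span_comp S T P p q =
     \<lparr>src = src S, trg = trg T, apex = P, lleg = lleg S \<bullet> p, rleg = rleg T \<bullet> q\<rparr>"

lemma is_span_comp:
  assumes "is_span S" "is_span T" "is_pullback (apex S) (apex T) Z (rleg S) (lleg T) P p q"
  shows "is_span (span_comp S T P p q)"
  using is_pullbackD[OF assms(3)] is_spanD[OF assms(1)] is_spanD[OF assms(2)]
  by (auto simp: is_span_def span_comp_def intro: rel_comp_hom)

text \<open>Composing a pullback cone with the isomorphisms of the apexes yields a cone over the
  other cospan; the two induced maps are mutually inverse by uniqueness.\<close>

lemma span_comp_iso:
  assumes S: "is_span S" "is_span S'" "span_iso S S'" and T: "is_span T" "is_span T'" "span_iso T T'"
    and pb: "is_pullback (apex S) (apex T) Z (rleg S) (lleg T) P p q"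
    and pb': "is_pullback (apex S') (apex T') Z (rleg S') (lleg T') P' p' q'"
  shows "span_iso (span_comp S T P p q) (span_comp S' T' P' p' q')"
proof -
  obtain h h' where h: "h \<in> rel_hom (apex S) (apex S')" "h' \<in> rel_hom (apex S') (apex S)"
    "h' \<bullet> h = rel_id (apex S)" "h \<bullet> h' = rel_id (apex S')"
    "lleg S' \<bullet> h = lleg S" "rleg S' \<bullet> h = rleg S"
    using span_isoE[OF S(3,1)] by blast
  obtain k k' where k: "k \<in> rel_hom (apex T) (apex T')" "k' \<in> rel_hom (apex T') (apex T)"
    "k' \<bullet> k = rel_id (apex T)" "k \<bullet> k' = rel_id (apex T')"
    "lleg T' \<bullet> k = lleg T" "rleg T' \<bullet> k = rleg T"
    using span_isoE[OF T(3,1)] by blast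
  note pbD = is_pullbackD[OF pb] and pbD' = is_pullbackD[OF pb']
  \<comment> \<open>The inner legs also commute with the inverse isomorphisms, which turns
    \<open>(p', q')\<close> into a cone over \<open>S\<close> and \<open>T\<close>.\<close>
  have S': "rleg S \<bullet> h' = rleg S'"
    using h(4,6) rel_comp_id(1)[OF is_spanD(3)[OF S(2)]] rel_comp_assoc by metis
  have T': "lleg T \<bullet> k' = lleg T'"
    using k(4,5) rel_comp_id(1)[OF is_spanD(2)[OF T(2)]] rel_comp_assoc by metis
  have "rleg S' \<bullet> (h \<bullet> p) = lleg T' \<bullet> (k \<bullet> q)"
    using pbD(6) h(6) k(5) by (metis rel_comp_assoc)
  then obtain m where m: "m \<in> rel_hom P P'" "p' \<bullet> m = h \<bullet> p" "q' \<bullet> m = k \<bullet> q"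
    using pullback_factor[OF pb' pbD(3) rel_comp_hom[OF pbD(4) h(1)] rel_comp_hom[OF pbD(5) k(1)]]
    by blast
  have "rleg S \<bullet> (h' \<bullet> p') = lleg T \<bullet> (k' \<bullet> q')"
    using pbD'(6) S' T' by (metis rel_comp_assoc)
  then obtain m' where m': "m' \<in> rel_hom P' P" "p \<bullet> m' = h' \<bullet> p'" "q \<bullet> m' = k' \<bullet> q'"
    using pullback_factor[OF pb pbD'(3) rel_comp_hom[OF pbD'(4) h(2)] rel_comp_hom[OF pbD'(5) k(2)]]
    by blast
  have "p \<bullet> (m' \<bullet> m) = p"
    using m m' h(3) rel_comp_id(2)[OF pbD(4)] by (metis rel_comp_assoc)
  moreover have "q \<bullet> (m' \<bullet> m) = q"
    using m m' k(3) rel_comp_id(2)[OF pbD(5)] by (metis rel_comp_assoc)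
  ultimately have 1: "m' \<bullet> m = rel_id P"
    using pullback_endo_id[OF pb] rel_comp_hom[OF m(1) m'(1)] by blast
  have "p' \<bullet> (m \<bullet> m') = p'"
    using m m' h(4) rel_comp_id(2)[OF pbD'(4)] by (metis rel_comp_assoc)
  moreover have "q' \<bullet> (m \<bullet> m') = q'"
    using m m' k(4) rel_comp_id(2)[OF pbD'(5)] by (metis rel_comp_assoc)
  ultimately have 2: "m \<bullet> m' = rel_id P'"
    using pullback_endo_id[OF pb'] rel_comp_hom[OF m'(1) m(1)] by blast
  have "lleg S' \<bullet> p' \<bullet> m = lleg S \<bullet> p" "rleg T' \<bullet> q' \<bullet> m = rleg T \<bullet> q"
    using m h(5) k(6) by (metis rel_comp_assoc)+
  moreover have "src S = src S'" "trg T = trg T'"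
    using S(3) T(3) by (auto simp: span_iso_def)
  ultimately show ?thesis
    using 1 2 m(1) m'(1) unfolding span_iso_def rel_iso_def span_comp_def by auto
qed

text \<open>All members of the union that defines \<open>Sp_comp\<close> are the same class, so
  computing a composite amounts to exhibiting one pullback.\<close>

lemma Sp_comp_span_class:
  assumes S: "is_span S" and T: "is_span T" and eq: "trg S = src T"
    and pb: "is_pullback (apex S) (apex T) (ord (trg S)) (rleg S) (lleg T) P p q"
  shows "Sp_comp (span_class S) (span_class T) = span_class (span_comp S T P p q)"
proof -
  have class_eq: "span_class (span_comp S' T' P' p' q') = span_class (span_comp S T P p q)"
    if "S' \<in> span_class S" "T' \<in> span_class T"
      and pb': "is_pullback (apex S') (apex T') (ord (trg S')) (rleg S') (lleg T') P' p' q'"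
    for S' T' P' p' q'
  proof -
    have S': "is_span S'" "span_iso S S'" and T': "is_span T'" "span_iso T T'"
      using that by (auto simp: span_class_def)
    then have "trg S' = trg S" by (auto simp: span_iso_def)
    then have pb'': "is_pullback (apex S') (apex T') (ord (trg S)) (rleg S') (lleg T') P' p' q'"
      using pb' by simp
    show ?thesis
      by (rule span_class_cong[symmetric])
         (use span_comp_iso[OF S S' T T' pb pb''] is_span_comp[OF S T pb]
              is_span_comp[OF S'(1) T'(1) pb''] in auto)
  qed
  \<comment> \<open>This makes the family under the union nonempty.\<close>
  have "S \<in> span_class S" "T \<in> span_class T"
    using S T by (auto simp: span_class_def span_iso_refl)
  then show ?thesis
    unfolding Sp_comp_def span_comp_def[symmetric] using class_eq eq pb by blast
qed

lemma rel_hom_sum: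
  assumes h: "h \<in> rel_hom X X'" and k: "k \<in> rel_hom Y Y'"
  shows "case_sum (\<lambda>x. Inl ` h x) (\<lambda>y. Inr ` k y) \<in> rel_hom (cset_sum X Y) (cset_sum X' Y')"
  using rel_homD[OF h] rel_homD[OF k]
  by (intro rel_homI) (auto simp: cset_sum_def split: sum.splits)

lemma span_sum_iso:
  assumes S: "is_span S" "span_iso S S'" and T: "is_span T" "span_iso T T'"
  shows "span_iso (span_sum S T) (span_sum S' T')"
proof -
  obtain h h' where h: "h \<in> rel_hom (apex S) (apex S')" "h' \<in> rel_hom (apex S') (apex S)"
    "h' \<bullet> h = rel_id (apex S)" "h \<bullet> h' = rel_id (apex S')"
    "lleg S' \<bullet> h = lleg S" "rleg S' \<bullet> h = rleg S"
    using span_isoE[OF S(2,1)] by blast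
  obtain k k' where k: "k \<in> rel_hom (apex T) (apex T')" "k' \<in> rel_hom (apex T') (apex T)"
    "k' \<bullet> k = rel_id (apex T)" "k \<bullet> k' = rel_id (apex T')"
    "lleg T' \<bullet> k = lleg T" "rleg T' \<bullet> k = rleg T"
    using span_isoE[OF T(2,1)] by blast
  have comp: "case_sum (\<lambda>x. Inl ` v x) (\<lambda>y. Inr ` w y) \<bullet> case_sum (\<lambda>x. Inl ` v' x) (\<lambda>y. Inr ` w' y) =
      rel_id (cset_sum X Y)" if "v \<bullet> v' = rel_id X" "w \<bullet> w' = rel_id Y" for v v' w w' X Y
  proof
    fix z
    show "(case_sum (\<lambda>x. Inl ` v x) (\<lambda>y. Inr ` w y) \<bullet> case_sum (\<lambda>x. Inl ` v' x) (\<lambda>y. Inr ` w' y)) z =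
      rel_id (cset_sum X Y) z"
      using fun_cong[OF that(1), of "projl z"] fun_cong[OF that(2), of "projr z"]
      by (cases z) (auto simp: rel_comp_apply rel_id_def cset_sum_def image_UN[symmetric]
          split: if_splits)
  qed
  have legs: "leg_sum c a b \<bullet> case_sum (\<lambda>x. Inl ` v x) (\<lambda>y. Inr ` w y) = leg_sum c (a \<bullet> v) (b \<bullet> w)"
    for c a b v w
    by (auto simp: fun_eq_iff rel_comp_apply leg_sum_def split: sum.splits)
  have "src S = src S'" "trg S = trg S'" "src T = src T'" "trg T = trg T'"
    using S T by (auto simp: span_iso_def)
  then show ?thesis
    unfolding span_iso_def rel_iso_def span_sum_def
    using rel_hom_sum[OF h(1) k(1)] rel_hom_sum[OF h(2) k(2)] comp[OF h(3) k(3)] comp[OF h(4) k(4)]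
    by (auto simp: legs h k intro!: exI[of _ "case_sum (\<lambda>x. Inl ` h x) (\<lambda>y. Inr ` k y)"])
qed

lemma Sp_tensor_span_class:
  fixes S T :: "nat cspan"
  assumes S: "is_span S" and T: "is_span T"
  shows "Sp_tensor (span_class S) (span_class T) = span_class (span_sum S T)"
proof -
  have class_eq: "span_class (span_sum S' T') = span_class (span_sum S T)"
    if "S' \<in> span_class S" "T' \<in> span_class T" for S' T'
    using that S T
    by (intro span_class_cong[symmetric] span_sum_is_span span_sum_iso) (auto simp: span_class_def)
  have "S \<in> span_class S" "T \<in> span_class T"
    using S T by (auto simp: span_class_def span_iso_refl)
  then show ?thesis unfolding Sp_tensor_def using class_eq by blast
qed


section \<open>Expressible spans\<close>

definition expressible :: "nat cspan \<Rightarrow> bool" where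
  "expressible S \<longleftrightarrow>
     is_span S \<and> (\<exists>e. has_type e (src S) (trg S) \<and> sem e = span_class S)"

text \<open>Carrying a span and its mirror image together through every construction provides the
  second factor of the final factorisation without a mirror operation on expressions.\<close>

definition biexpressible :: "nat cspan \<Rightarrow> bool" where
  "biexpressible S \<longleftrightarrow> expressible S \<and> expressible (dagger S)"

lemma expressible_iso:
  assumes "expressible S" "is_span T" "span_iso S T"
  shows "expressible T"
proof -
  have "src T = src S" "trg T = trg S"
    using assms(3) by (auto simp: span_iso_def)
  moreover have "span_class T = span_class S"
    using assms span_class_cong unfolding expressible_def by blast
  ultimately show ?thesis
    using assms unfolding expressible_def by simp
qed

lemma expressible_comp:
  assumes S: "expressible S" and T: "expressible T" and eq: "trg S = src T"
    and pb: "is_pullback (apex S) (apex T) (ord (trg S)) (rleg S) (lleg T) P p q"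
  shows "expressible (span_comp S T P p q)"
proof -
  obtain e e' where e: "has_type e (src S) (trg S)" "sem e = span_class S"
    "has_type e' (src T) (trg T)" "sem e' = span_class T"
    using S T by (auto simp: expressible_def)
  have "is_span S" "is_span T" using S T by (auto simp: expressible_def)
  then have "is_span (span_comp S T P p q)" "sem (Seq e e') = span_class (span_comp S T P p q)"
    using is_span_comp[OF _ _ pb] Sp_comp_span_class[OF _ _ eq pb] e by auto
  moreover have "has_type (Seq e e') (src S) (trg T)"
    using e eq by (auto intro: has_type.intros)
  ultimately show ?thesis
    unfolding expressible_def by (auto simp: span_comp_def)
qed

text \<open>\<open>span_sum\<close> lives on a sum type while expressible spans have apexes in
  \<open>nat\<close>, so the result is stated for any isomorphic copy \<open>U\<close>.\<close>

lemma expressible_tensor: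
  assumes S: "expressible S" and T: "expressible T" and U: "is_span U" "span_iso (span_sum S T) U"
  shows "expressible U"
proof -
  obtain e e' where e: "has_type e (src S) (trg S)" "sem e = span_class S"
    "has_type e' (src T) (trg T)" "sem e' = span_class T"
    using S T by (auto simp: expressible_def)
  have sp: "is_span S" "is_span T" using S T by (auto simp: expressible_def)
  have "sem (Par e e') = span_class U"
    using e Sp_tensor_span_class[OF sp] span_class_cong[OF span_sum_is_span[OF sp] U] by simp
  moreover have "src U = src S + src T" "trg U = trg S + trg T"
    using U(2) by (auto simp: span_iso_def span_sum_def)
  ultimately show ?thesis
    using U(1) e unfolding expressible_def by (auto intro!: exI[of _ "Par e e'"] has_type.intros)
qed

lemma biexpressible_is_span: "biexpressible S \<Longrightarrow> is_span S"
  by (simp add: biexpressible_def expressible_def)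

lemma biexpressible_comp:
  assumes S: "biexpressible S" and T: "biexpressible T" and eq: "trg S = src T"
    and pb: "is_pullback (apex S) (apex T) (ord (trg S)) (rleg S) (lleg T) P p q"
  shows "biexpressible (span_comp S T P p q)"
proof -
  \<comment> \<open>Mirroring reverses the order of composition and transposes the pullback
    square.\<close>
  have "expressible (span_comp (dagger T) (dagger S) P q p)"
    using expressible_comp[of "dagger T" "dagger S" P q p] is_pullback_sym[OF pb] S T eq
    by (simp add: biexpressible_def)
  moreover have "dagger (span_comp S T P p q) = span_comp (dagger T) (dagger S) P q p"
    by (simp add: dagger_def span_comp_def)
  ultimately show ?thesis
    using expressible_comp[OF _ _ eq pb] S T by (simp add: biexpressible_def)
qed

lemma biexpressible_tensor:
  assumes "biexpressible S" "biexpressible T" "is_span U" "span_iso (span_sum S T) U"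
  shows "biexpressible U"
  using assms expressible_tensor[of S T U] expressible_tensor[of "dagger S" "dagger T" "dagger U"]
  by (simp add: biexpressible_def dagger_span_sum[symmetric])

lemma expressible_gen_span: "expressible (gen_span g)"
  unfolding expressible_def using gen_span_is_span has_type.intros(1) sem.simps(1) by blast


section \<open>Spans whose right leg is an identity\<close>

text \<open>If one leg of a cospan is \<open>x \<mapsto> {x}\<close>, a pair of independent sets with the same image is
  determined by its component on the other side, so the pullback is the apex of the other side
  with the contention of both sides.\<close>

lemma is_pullback_rel_id:
  assumes X: "carrier X = {..<n}" "fin_cset X" and Y: "fin_cset Y"
    and g: "g \<in> rel_hom Y (ord n)" and ind: "\<And>y. y \<in> carrier Y \<Longrightarrow> independent X (g y)"
  defines "P \<equiv> \<lparr>carrier = carrier Y, con = {(y, y'). y \<in> carrier Y \<and> y' \<in> carrier Y \<and>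
     ((y, y') \<in> con Y \<or> (\<exists>u\<in>g y. \<exists>u'\<in>g y'. (u, u') \<in> con X))}\<rparr>"
  shows "is_pullback X Y (ord n) (rel_id X) g P g (rel_id Y)"
proof -
  have symX: "(y, x) \<in> con X" if "(x, y) \<in> con X" for x y
    using X(2) that by (auto simp: fin_cset_def)
  have gX: "x \<in> carrier X" if "y \<in> carrier Y" "x \<in> g y" for x y
    using ind that by (auto simp: independent_def)
  have conP: "(y, y') \<in> con P \<longleftrightarrow> y \<in> carrier Y \<and> y' \<in> carrier Y \<and>
     ((y, y') \<in> con Y \<or> (\<exists>u\<in>g y. \<exists>u'\<in>g y'. (u, u') \<in> con X))" for y y'
    by (simp add: P_def)
  have carP: "carrier P = carrier Y" by (simp add: P_def)
  have P: "fin_cset P"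
    using Y symX unfolding fin_cset_def by (auto simp: conP carP subset_iff) blast+
  have id: "rel_id X \<in> rel_hom X (ord n)"
    using X by (intro rel_homI) (auto simp: rel_id_def ord_def discrete_def fin_cset_def
        split: if_splits)
  have gP: "g \<in> rel_hom P X"
    using ind rel_homD(4)[OF g] by (intro rel_homI) (auto simp: carP conP independent_def)
  have idP: "rel_id Y \<in> rel_hom P Y"
    by (intro rel_homI) (auto simp: carP conP rel_id_def split: if_splits)
  have comm: "rel_id X \<bullet> g = g \<bullet> rel_id Y"
    using rel_comp_id[OF gP] rel_comp_id[OF g] by simp
  have "\<exists>!m. m \<in> rel_hom W P \<and> g \<bullet> m = p' \<and> rel_id Y \<bullet> m = q'"
    if W: "fin_cset W" "p' \<in> rel_hom W X" "q' \<in> rel_hom W Y" "rel_id X \<bullet> p' = g \<bullet> q'"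
    for W :: "nat cset" and p' q'
  \<comment> \<open>The second projection is the identity on elements, so the mediating map can only
    be \<open>q'\<close>; the work lies in showing that it respects the larger contention of
    \<open>P\<close>.\<close>
  proof (rule ex1I[of _ q'], intro conjI)
    have p': "p' = g \<bullet> q'" using W(4) rel_comp_id(2)[OF W(2)] by simp
    have sub: "u \<in> p' w" if "y \<in> q' w" "u \<in> g y" for u y w
      using that by (auto simp: p' rel_comp_apply)
    have reflect: "(w, w') \<in> con W"
      if "w \<in> carrier W" "w' \<in> carrier W" "y \<in> q' w" "y' \<in> q' w'" "(y, y') \<in> con P" for w w' y y'
      using that rel_homD(3)[OF W(2)] rel_homD(3)[OF W(3)] sub unfolding conP by blast
    have "y = y'" if asm: "w \<in> carrier W" "y \<in> q' w" "y' \<in> q' w" "(y, y') \<in> con P" for w y y'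
    proof -
      have y: "y \<in> carrier Y" "y' \<in> carrier Y" using asm(4) unfolding conP by blast+
      have "(y, y') \<in> con Y"
      proof (rule ccontr)
        \<comment> \<open>The contention then comes from \<open>X\<close>: \<open>u\<close> and
          \<open>u'\<close> lie in the independent set \<open>p' w\<close>, so they coincide, and a
          common element of \<open>g y\<close> and \<open>g y'\<close> forces contention in
          \<open>Y\<close>.\<close>
        assume "(y, y') \<notin> con Y"
        then obtain u u' where u: "u \<in> g y" "u' \<in> g y'" "(u, u') \<in> con X"
          using asm(4) unfolding conP by blast
        then have "u = u'" using rel_homD(2)[OF W(2) asm(1)] sub asm(2,3) u by blast
        then have "(u, u') \<in> con (ord n)"
          using rel_homD(1)[OF g y(1) u(1)] by (auto simp: ord_def discrete_def)
        with u show False using rel_homD(3)[OF g y] \<open>(y, y') \<notin> con Y\<close> by blast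
      qed
      then show ?thesis using rel_homD(2)[OF W(3)] asm by blast
    qed
    then show "q' \<in> rel_hom W P"
      using rel_homD(1,4)[OF W(3)] reflect by (intro rel_homI) (auto simp: carP)
    show "g \<bullet> q' = p'" by (simp add: p')
    show "rel_id Y \<bullet> q' = q'" by (rule rel_comp_id(2)[OF W(3)])
  next
    fix m assume m: "m \<in> rel_hom W P \<and> g \<bullet> m = p' \<and> rel_id Y \<bullet> m = q'"
    \<comment> \<open>\<open>rel_id\<close> depends on the carrier only, and \<open>P\<close>
      differs from \<open>Y\<close> only in its contention.\<close>
    have "rel_id Y = rel_id P" by (simp add: rel_id_def carP)
    then show "m = q'" using m rel_comp_id(2)[of m W P] by simp
  qed
  then show ?thesis
    unfolding is_pullback_def using id g P gP idP comm by (intro conjI allI impI) auto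
qed

section \<open>Spans \<open>k \<leftarrow> X \<rightarrow> n\<close> with apex
  \<open>{..<n}\<close>, in coordinates\<close>

definition cset_upto :: "nat \<Rightarrow> (nat \<Rightarrow> nat \<Rightarrow> bool) \<Rightarrow> nat cset" where
  "cset_upto n c = \<lparr>carrier = {..<n}, con = {(x, y). x < n \<and> y < n \<and> c x y}\<rparr>"

definition rspan :: "nat \<Rightarrow> nat \<Rightarrow> (nat \<Rightarrow> nat \<Rightarrow> bool) \<Rightarrow> (nat \<Rightarrow> nat set) \<Rightarrow> nat cspan" where
  "rspan k n c a = mk_span k n (cset_upto n c) a (\<lambda>x. {x})"

text \<open>Exactly the validity of \<open>rspan k n c a\<close> as a span; the clause on
  intersections is the morphism condition of the left leg.\<close>

definition rspan_ok :: "nat \<Rightarrow> nat \<Rightarrow> (nat \<Rightarrow> nat \<Rightarrow> bool) \<Rightarrow> (nat \<Rightarrow> nat set) \<Rightarrow> bool" where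
  "rspan_ok k n c a \<longleftrightarrow> (\<forall>x<n. c x x \<and> a x \<subseteq> {..<k}) \<and>
     (\<forall>x<n. \<forall>y<n. (c x y \<longrightarrow> c y x) \<and> (a x \<inter> a y \<noteq> {} \<longrightarrow> c x y))"

text \<open>An ordinal is discrete, so all its subsets are independent, and two of them are in
  contention exactly when they meet.\<close>

lemma leg_upto_iff:
  "(\<lambda>x. if x < n then a x else {}) \<in> rel_hom (cset_upto n c) (ord k) \<longleftrightarrow>
     (\<forall>x<n. a x \<subseteq> {..<k}) \<and> (\<forall>x<n. \<forall>y<n. a x \<inter> a y \<noteq> {} \<longrightarrow> c x y)" (is "?a \<in> ?H \<longleftrightarrow> ?R")
proof
  assume *: "?a \<in> ?H"
  show ?R
  proof (intro conjI allI impI subsetI)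
    fix x z assume "x < n" "z \<in> a x"
    then show "z \<in> {..<k}"
      using rel_homD(1)[OF *, of x z] by (simp add: cset_upto_def ord_def discrete_def)
  next
    fix x y assume xy: "x < n" "y < n" "a x \<inter> a y \<noteq> {}"
    then obtain z where z: "z \<in> a x" "z \<in> a y" by blast
    have "z < k"
      using rel_homD(1)[OF *, of x z] xy z by (simp add: cset_upto_def ord_def discrete_def)
    then show "c x y"
      using rel_homD(3)[OF *, of x y z z] xy z by (simp add: cset_upto_def ord_def discrete_def Id_on_iff)
  qed
next
  assume ?R
  then have lt: "z < k" and sh: "c x y" if "x < n" "y < n" "z \<in> a x" "z \<in> a y" for x y z
    using that by blast+
  show "?a \<in> ?H"
    using lt sh by (intro rel_homI) (auto simp: cset_upto_def ord_def discrete_def split: if_splits)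
qed

lemma rspan_sel:
  "src (rspan k n c a) = k" "trg (rspan k n c a) = n" "apex (rspan k n c a) = cset_upto n c"
  "lleg (rspan k n c a) = (\<lambda>x. if x < n then a x else {})"
  "rleg (rspan k n c a) = rel_id (cset_upto n c)"
  by (auto simp: rspan_def mk_span_def cset_upto_def rel_id_def)

lemma is_span_rspan: "is_span (rspan k n c a) \<longleftrightarrow> rspan_ok k n c a"
proof -
  have fin: "fin_cset (cset_upto n c) \<longleftrightarrow>
      (\<forall>x<n. c x x) \<and> (\<forall>x<n. \<forall>y<n. c x y \<longrightarrow> c y x)"
    by (auto simp: fin_cset_def cset_upto_def)
  have "rel_id (cset_upto n c) = (\<lambda>x. if x < n then {x} else {})"
    by (simp add: rel_id_def cset_upto_def)
  then have "rel_id (cset_upto n c) \<in> rel_hom (cset_upto n c) (ord n) \<longleftrightarrow> (\<forall>x<n. c x x)"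
    using leg_upto_iff[of n "\<lambda>x. {x}" c n] by simp
  then have "is_span (rspan k n c a) \<longleftrightarrow> ((\<forall>x<n. c x x) \<and> (\<forall>x<n. \<forall>y<n. c x y \<longrightarrow> c y x)) \<and>
      (((\<forall>x<n. a x \<subseteq> {..<k}) \<and> (\<forall>x<n. \<forall>y<n. a x \<inter> a y \<noteq> {} \<longrightarrow> c x y)) \<and> (\<forall>x<n. c x x))"
    unfolding is_span_def rspan_sel fin leg_upto_iff[of n a c k] by (rule arg_cong)
  also have "\<dots> \<longleftrightarrow> rspan_ok k n c a"
    unfolding rspan_ok_def by (simp only: all_conj_distrib imp_conjR) blast
  finally show ?thesis .
qed

lemma rspan_cong:
  assumes "\<And>x. x < n \<Longrightarrow> a x = a' x" "\<And>x y. x < n \<Longrightarrow> y < n \<Longrightarrow> c x y \<longleftrightarrow> c' x y"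
  shows "rspan k n c a = rspan k n c' a'"
  using assms unfolding rspan_def mk_span_def cset_upto_def by (auto simp: fun_eq_iff)

definition rexpressible :: "nat \<Rightarrow> nat \<Rightarrow> (nat \<Rightarrow> nat \<Rightarrow> bool) \<Rightarrow> (nat \<Rightarrow> nat set) \<Rightarrow> bool" where
  "rexpressible k n c a \<longleftrightarrow> biexpressible (rspan k n c a)"

text \<open>Composites and tensors produce \<open>c\<close> and \<open>a\<close> as unwieldy
  formulas; this rule replaces them by simpler ones that agree below \<open>n\<close>.\<close>

lemma rexpressible_cong:
  assumes "rexpressible k n c a" "k = k'" "n = n'"
    and "\<And>x. x < n \<Longrightarrow> a x = a' x" "\<And>x y. x < n \<Longrightarrow> y < n \<Longrightarrow> c x y \<longleftrightarrow> c' x y"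
  shows "rexpressible k' n' c' a'"
  using assms rspan_cong[of n a a' c c' k] by (simp add: rexpressible_def)

lemma rexpressible_ok: "rexpressible k n c a \<Longrightarrow> rspan_ok k n c a"
  by (simp add: rexpressible_def biexpressible_is_span is_span_rspan[symmetric])

text \<open>Events of the first span are the wires of the second, so their contention is inherited
  by the events that use them. The hypothesis \<open>ind\<close> makes each \<open>b y\<close>
  independent in the first apex, as the explicit pullback requires.\<close>

lemma rexpressible_comp:
  assumes S: "rexpressible k n c a" and T: "rexpressible n m d b"
    and ind: "\<And>y u u'. y < m \<Longrightarrow> u \<in> b y \<Longrightarrow> u' \<in> b y \<Longrightarrow> c u u' \<Longrightarrow> u = u'"
  shows "rexpressible k m (\<lambda>y y'. d y y' \<or> (\<exists>u\<in>b y. \<exists>u'\<in>b y'. c u u')) (\<lambda>y. \<Union>u\<in>b y. a u)"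
proof -
  let ?b = "\<lambda>x. if x < m then b x else {}"
  let ?P = "\<lparr>carrier = carrier (cset_upto m d), con = {(y, y'). y \<in> carrier (cset_upto m d) \<and>
     y' \<in> carrier (cset_upto m d) \<and> ((y, y') \<in> con (cset_upto m d) \<or>
     (\<exists>u\<in>?b y. \<exists>u'\<in>?b y'. (u, u') \<in> con (cset_upto n c)))}\<rparr>"
  have sp: "is_span (rspan k n c a)" "is_span (rspan n m d b)"
    using S T by (auto simp: rexpressible_def biexpressible_is_span)
  have bn: "u < n" if "y < m" "u \<in> b y" for u y
    using rexpressible_ok[OF T] that by (auto simp: rspan_ok_def)
  have "is_pullback (cset_upto n c) (cset_upto m d) (ord n) (rel_id (cset_upto n c)) ?b ?P ?b
    (rel_id (cset_upto m d))"
    using is_spanD[OF sp(1)] is_spanD[OF sp(2)] ind bn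
    by (intro is_pullback_rel_id) (auto simp: rspan_sel independent_def cset_upto_def)
  then have "biexpressible (span_comp (rspan k n c a) (rspan n m d b) ?P ?b (rel_id (cset_upto m d)))"
    using S T by (intro biexpressible_comp) (auto simp: rspan_sel rexpressible_def)
  moreover have "span_comp (rspan k n c a) (rspan n m d b) ?P ?b (rel_id (cset_upto m d)) =
    rspan k m (\<lambda>y y'. d y y' \<or> (\<exists>u\<in>b y. \<exists>u'\<in>b y'. c u u')) (\<lambda>y. \<Union>u\<in>b y. a u)"
    using bn by (auto simp: span_comp_def rspan_def mk_span_def fun_eq_iff rel_comp_apply
        cset_upto_def rel_id_def split: if_splits)
  ultimately show ?thesis by (simp add: rexpressible_def)
qed

lemma rexpressible_tensor:
  assumes S: "rexpressible k n c a" and T: "rexpressible k' n' c' a'"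
  shows "rexpressible (k + k') (n + n')
    (\<lambda>x y. if x < n \<and> y < n then c x y else n \<le> x \<and> n \<le> y \<and> c' (x - n) (y - n))
    (\<lambda>x. if x < n then a x else (+) k ` a' (x - n))" (is "rexpressible _ _ ?c ?a")
proof -
  have ok: "rspan_ok k n c a" "rspan_ok k' n' c' a'" using S T by (auto dest: rexpressible_ok)
  have lt: "z < k" if "x < n" "z \<in> a x" for x z
    using ok that by (auto simp: rspan_ok_def)
  have lt': "z < k'" if "x < n'" "z \<in> a' x" for x z
    using ok that by (auto simp: rspan_ok_def)
  have sh: "c x y" if "x < n" "y < n" "z \<in> a x" "z \<in> a y" for x y z
    using ok(1) that unfolding rspan_ok_def by blast
  have sh': "c' x y" if "x < n'" "y < n'" "z \<in> a' x" "z \<in> a' y" for x y z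
    using ok(2) that unfolding rspan_ok_def by blast
  have sym: "c x y \<longleftrightarrow> c y x" if "x < n" "y < n" for x y
    using ok that by (auto simp: rspan_ok_def)
  have sym': "c' x y \<longleftrightarrow> c' y x" if "x < n'" "y < n'" for x y
    using ok that by (auto simp: rspan_ok_def)
  have "rspan_ok (k + k') (n + n') ?c ?a"
    unfolding rspan_ok_def
  proof (intro conjI allI impI)
    fix x assume "x < n + n'"
    then show "?c x x"
      using ok by (auto simp: rspan_ok_def)
    show "?a x \<subseteq> {..<k + k'}"
      using \<open>x < n + n'\<close> lt[of x] lt'[of "x - n"] by (cases "x < n") (auto intro: trans_less_add1)
  next
    fix x y assume xy: "x < n + n'" "y < n + n'"
    show "?c x y \<Longrightarrow> ?c y x"
      using xy sym[of x y] sym'[of "x - n" "y - n"] by (cases "x < n"; cases "y < n") auto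
    assume "?a x \<inter> ?a y \<noteq> {}"
    then obtain z where z: "z \<in> ?a x" "z \<in> ?a y" by blast
    show "?c x y"
      using xy z sh[of x y z] sh'[of "x - n" "y - n" "z - k"] lt[of x z] lt[of y z]
      by (cases "x < n"; cases "y < n") auto
  qed
  then have U: "is_span (rspan (k + k') (n + n') ?c ?a)" by (simp add: is_span_rspan)
  have sp: "is_span (rspan k n c a)" "is_span (rspan k' n' c' a')"
    using ok by (auto simp: is_span_rspan)
  \<comment> \<open>The events of the second summand are numbered after those of the first.\<close>
  have "bij_betw (case_sum id ((+) n)) ({..<n} <+> {..<n'}) {..<n + n'}"
  proof (rule bij_betw_imageI)
    show "inj_on (case_sum id ((+) n)) ({..<n} <+> {..<n'})"
      by (auto simp: inj_on_def)
    have "x \<in> case_sum id ((+) n) ` ({..<n} <+> {..<n'})" if "x < n + n'" for x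
    proof (cases "x < n")
      case True
      then show ?thesis by (intro image_eqI[of _ _ "Inl x"]) auto
    next
      case False
      then show ?thesis using that by (intro image_eqI[of _ _ "Inr (x - n)"]) auto
    qed
    then show "case_sum id ((+) n) ` ({..<n} <+> {..<n'}) = {..<n + n'}" by auto
  qed
  then have "span_iso (span_sum (rspan k n c a) (rspan k' n' c' a')) (rspan (k + k') (n + n') ?c ?a)"
    by (intro span_iso_bij_betw[OF span_sum_is_span[OF sp] U, of "case_sum id ((+) n)"])
       (auto simp: span_sum_def rspan_sel cset_sum_def cset_upto_def leg_sum_def rel_id_def)
  then show ?thesis
    using biexpressible_tensor S T U unfolding rexpressible_def by blast
qed

section \<open>Generators in coordinates\<close>

lemma rexpressible_gen_span:
  assumes "gen_span g = rspan k n c a" "gen_span g' = dagger (rspan k n c a)"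
  shows "rexpressible k n c a"
  using expressible_gen_span[of g] expressible_gen_span[of g'] assms
  by (simp add: rexpressible_def biexpressible_def)

text \<open>Mirroring pairs \<open>Wire\<close> with itself, \<open>Nabla\<close> with
  \<open>Delta\<close>, \<open>Top\<close> with \<open>Bot\<close>, \<open>Down\<close> with
  \<open>Up\<close> and \<open>Lambda\<close> with \<open>Vee\<close>; in each pair one generator
  equals an \<open>rspan\<close> exactly.\<close>

lemma rexpressible_wire: "rexpressible 1 1 (=) (\<lambda>_. {0})"
  by (rule rexpressible_gen_span[of Wire _ _ _ _ Wire])
     (auto simp: rspan_def dagger_def mk_span_def discrete_def cset_upto_def fun_eq_iff)

lemma rexpressible_nabla: "rexpressible 2 1 (=) (\<lambda>_. {0, 1})"
  by (rule rexpressible_gen_span[of Nabla _ _ _ _ Delta])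
     (auto simp: rspan_def dagger_def mk_span_def discrete_def cset_upto_def fun_eq_iff)

lemma rexpressible_top: "rexpressible 0 1 (=) (\<lambda>_. {})"
  by (rule rexpressible_gen_span[of Top _ _ _ _ Bot])
     (auto simp: rspan_def dagger_def mk_span_def discrete_def cset_upto_def fun_eq_iff)

lemma rexpressible_down: "rexpressible 1 0 c a"
  by (rule rexpressible_gen_span[of Down _ _ _ _ Up])
     (auto simp: rspan_def dagger_def mk_span_def discrete_def cset_upto_def fun_eq_iff)

lemma rexpressible_lambda: "rexpressible 1 2 (\<lambda>_ _. True) (\<lambda>_. {0})"
  by (rule rexpressible_gen_span[of Lambda _ _ _ _ Vee])
     (auto simp: rspan_def dagger_def mk_span_def indiscrete_def cset_upto_def fun_eq_iff)

text \<open>\<open>Twist\<close> has its identity leg on the left, so it equals the mirror image of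
  this \<open>rspan\<close>. The \<open>rspan\<close> itself is only isomorphic to it, by exchanging
  the two events.\<close>

lemma rexpressible_twist: "rexpressible 2 2 (=) (\<lambda>i. {1 - i})"
proof -
  let ?R = "rspan 2 2 (=) (\<lambda>i. {1 - i})"
  have dag: "dagger ?R = gen_span Twist"
    by (auto simp: rspan_def dagger_def mk_span_def discrete_def cset_upto_def fun_eq_iff)
  then have R: "is_span ?R"
    using gen_span_is_span[of Twist] is_span_dagger by metis
  have "bij_betw (\<lambda>i. 1 - i) {0, 1::nat} {..<2}"
    by (auto simp: bij_betw_def inj_on_def image_def)
  then have "span_iso (gen_span Twist) ?R"
    by (intro span_iso_bij_betw[OF gen_span_is_span R, of _ "\<lambda>i. 1 - i"])
       (auto simp: rspan_sel mk_span_def discrete_def cset_upto_def rel_id_def)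
  then have "expressible ?R"
    using expressible_iso[OF expressible_gen_span R] by blast
  then show ?thesis
    using expressible_gen_span[of Twist] unfolding rexpressible_def biexpressible_def dag by blast
qed

section \<open>Building spans event by event\<close>

lemma rexpressible_id: "rexpressible k k (=) (\<lambda>x. {x})"
proof (induction k)
  case 0
  \<comment> \<open>No generator has type \<open>0 \<rightarrow> 0\<close>; \<open>Top\<close>
    followed by \<open>Down\<close> gives the empty span.\<close>
  show ?case by (rule rexpressible_cong[OF rexpressible_comp[OF rexpressible_top rexpressible_down]]) auto
next
  case (Suc k)
  show ?case by (rule rexpressible_cong[OF rexpressible_tensor[OF Suc rexpressible_wire]]) auto
qed

lemma rexpressible_empty: "rexpressible k 0 c a"
proof (induction k)
  case 0
  show ?case by (rule rexpressible_cong[OF rexpressible_id]) auto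
next
  case (Suc k)
  show ?case by (rule rexpressible_cong[OF rexpressible_tensor[OF Suc rexpressible_down]]) auto
qed

lemma rexpressible_merge_last: "rexpressible (n + 2) (n + 1) (=) (\<lambda>x. if x < n then {x} else {n, n + 1})"
  by (rule rexpressible_cong[OF rexpressible_tensor[OF rexpressible_id rexpressible_nabla]]) auto

text \<open>Tensoring with identities lets \<open>Lambda\<close> copy the last wire. For an earlier
  \<open>u\<close>, the copy is produced by induction in front of the last wire and then moved
  behind it by a twist.\<close>

lemma rexpressible_copy:
  "u < k \<Longrightarrow> rexpressible k (k + 1) (\<lambda>x y. x = y \<or> x = u \<and> y = k \<or> x = k \<and> y = u)
     (\<lambda>x. if x < k then {x} else {u})"
proof (induction k)
  case (Suc k)
  show ?case
  proof (cases "u = k")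
    case True
    have "rexpressible (k + 1) (k + 2) (\<lambda>x y. x = y \<or> x = u \<and> y = k + 1 \<or> x = k + 1 \<and> y = u)
        (\<lambda>x. if x < k + 1 then {x} else {u})"
      by (rule rexpressible_cong[OF rexpressible_tensor[OF rexpressible_id rexpressible_lambda]]) (auto simp: True)
    then show ?thesis by simp
  next
    case False
    then have u: "u < k" using Suc.prems by simp
    have swap: "rexpressible (k + 2) (k + 2) (=)
        (\<lambda>x. if x < k then {x} else if x = k then {k + 1} else {k})"
      by (rule rexpressible_cong[OF rexpressible_tensor[OF rexpressible_id rexpressible_twist]]) auto
    \<comment> \<open>Here event \<open>k\<close> is the copy of \<open>u\<close>, and event
      \<open>k + 1\<close> carries the last wire \<open>k\<close>.\<close>
    have copy: "rexpressible (k + 1) (k + 2) (\<lambda>x y. x = y \<or> x = u \<and> y = k \<or> x = k \<and> y = u)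
        (\<lambda>x. if x < k then {x} else if x = k then {u} else {k})"
      by (rule rexpressible_cong[OF rexpressible_tensor[OF Suc.IH[OF u] rexpressible_wire]]) (use u in auto)
    have "rexpressible (k + 1) (k + 2) (\<lambda>x y. x = y \<or> x = u \<and> y = k + 1 \<or> x = k + 1 \<and> y = u)
        (\<lambda>x. if x < k + 1 then {x} else {u})"
      by (rule rexpressible_cong[OF rexpressible_comp[OF copy swap]]) (use u in \<open>auto split: if_splits\<close>)
    then show ?thesis by simp
  qed
qed simp

text \<open>The wire \<open>u\<close> is copied, the copy bypasses the old span as an extra event
  \<open>n + 1\<close>, and \<open>Nabla\<close> merges that event into \<open>n\<close>. Since
  \<open>u \<notin> a n\<close>, the events \<open>n\<close> and \<open>n + 1\<close> are not in
  contention, which merging requires.\<close>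

lemma rexpressible_add_edge:
  assumes S: "rexpressible k (n + 1) c a" and u: "u < k" "u \<notin> a n"
  shows "rexpressible k (n + 1) (\<lambda>x y. c x y \<or> x = n \<and> u \<in> a y \<or> y = n \<and> u \<in> a x)
    (a(n := insert u (a n)))"
proof -
  have ak: "z < k" if "x \<le> n" "z \<in> a x" for x z
    using rexpressible_ok[OF S] that unfolding rspan_ok_def
    by (metis Suc_eq_plus1 le_imp_less_Suc lessThan_iff subsetD)
  have sh: "c x y" if "x \<le> n" "y \<le> n" "z \<in> a x" "z \<in> a y" for x y z
    using rexpressible_ok[OF S] that unfolding rspan_ok_def by (meson disjoint_iff less_add_one le_less_trans)
  have refl: "c x x" if "x \<le> n" for x
    using rexpressible_ok[OF S] that by (auto simp: rspan_ok_def)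
  have wire: "rexpressible (k + 1) (n + 2) (\<lambda>x y. if x \<le> n \<and> y \<le> n then c x y else x = y)
      (\<lambda>x. if x \<le> n then a x else {k})"
    by (rule rexpressible_cong[OF rexpressible_tensor[OF S rexpressible_wire]]) auto
  have copied: "rexpressible k (n + 2)
      (\<lambda>x y. if x \<le> n \<and> y \<le> n then c x y else x = y \<or> x \<le> n \<and> u \<in> a x \<or> y \<le> n \<and> u \<in> a y)
      (\<lambda>x. if x \<le> n then a x else {u})"
    by (rule rexpressible_cong[OF rexpressible_comp[OF rexpressible_copy[OF u(1)] wire]])
       (use u in \<open>auto split: if_splits dest: ak intro: sh\<close>)
  show ?thesis
    by (rule rexpressible_cong[OF rexpressible_comp[OF copied rexpressible_merge_last]])
       (use u in \<open>auto split: if_splits simp: refl less_Suc_eq\<close>)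
qed

text \<open>\<open>Top\<close> creates the event without wires; its edges are then added one at a
  time.\<close>

lemma rexpressible_add_event:
  assumes S: "rexpressible k n c a" and U: "finite U" "U \<subseteq> {..<k}"
  shows "rexpressible k (n + 1)
    (\<lambda>x y. if x < n \<and> y < n then c x y else x = y \<or> x < n \<and> a x \<inter> U \<noteq> {} \<or> y < n \<and> a y \<inter> U \<noteq> {})
    (\<lambda>x. if x < n then a x else U)"
  using U
proof (induction U rule: finite_induct)
  case empty
  show ?case by (rule rexpressible_cong[OF rexpressible_tensor[OF S rexpressible_top]]) auto
next
  case (insert u U)
  then have u: "u < k" and IH: "rexpressible k (n + 1)
    (\<lambda>x y. if x < n \<and> y < n then c x y else x = y \<or> x < n \<and> a x \<inter> U \<noteq> {} \<or> y < n \<and> a y \<inter> U \<noteq> {})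
    (\<lambda>x. if x < n then a x else U)"
    by auto
  \<comment> \<open>The new event \<open>n\<close> uses the wires \<open>U\<close> so far, and
    \<open>insert.hyps\<close> gives \<open>u \<notin> U\<close>, the condition for adding an
    edge.\<close>
  show ?case
    by (rule rexpressible_cong[OF rexpressible_add_edge[OF IH u]]) (use insert.hyps in auto)
qed

text \<open>The wires from \<open>k\<close> on are fed by \<open>Top\<close>, the last one first.
  Composition adds contention only between events that share a wire, and \<open>c\<close> contains
  that already.\<close>

lemma rexpressible_close_wires: "rexpressible (k + m) n c a \<Longrightarrow> rexpressible k n c (\<lambda>x. a x \<inter> {..<k})"
proof (induction m arbitrary: a)
  case 0
  have "a x \<inter> {..<k} = a x" if "x < n" for x
    using rexpressible_ok[OF 0] that by (auto simp: rspan_ok_def)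
  then show ?case using 0 by (auto intro: rexpressible_cong)
next
  case (Suc m)
  have ok: "rspan_ok (k + m + 1) n c a" using rexpressible_ok[OF Suc.prems] by simp
  have lt: "z < k + m + 1" if "x < n" "z \<in> a x" for x z
    using ok that by (auto simp: rspan_ok_def)
  have sh: "c x y" if "x < n" "y < n" "z \<in> a x" "z \<in> a y" for x y z
    using ok that unfolding rspan_ok_def by blast
  have top: "rexpressible (k + m) (k + m + 1) (=) (\<lambda>x. if x < k + m then {x} else {})"
    by (rule rexpressible_cong[OF rexpressible_tensor[OF rexpressible_id rexpressible_top]]) auto
  have "rexpressible (k + m) n c (\<lambda>x. a x \<inter> {..<k + m})"
    by (rule rexpressible_cong[OF rexpressible_comp[OF top, of n c a]])
       (use Suc.prems in \<open>auto split: if_splits intro: sh\<close>)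
  then have "rexpressible k n c (\<lambda>x. a x \<inter> {..<k + m} \<inter> {..<k})" by (rule Suc.IH)
  then show ?case by (rule rexpressible_cong) auto
qed

text \<open>Contention between the new event \<open>n\<close> and an older event \<open>y\<close> is created by letting both use
  an auxiliary wire \<open>k + y\<close>, which is closed afterwards: closing a wire does not remove the
  contention it caused.\<close>

lemma rexpressible_rspan_ok: "rspan_ok k n c a \<Longrightarrow> rexpressible k n c a"
proof (induction n arbitrary: k a)
  case 0
  show ?case by (rule rexpressible_empty)
next
  case (Suc n)
  \<comment> \<open>Each event \<open>y\<close> has its own auxiliary wire \<open>k + y\<close>, so
    these wires cause no contention among the old events. The induction hypothesis is needed at
    \<open>k + n\<close> wires and for the changed leg \<open>a'\<close>.\<close>
  define a' where "a' = (\<lambda>y. a y \<union> (if c y n then {k + y} else {}))"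
  define U where "U = a n \<union> {k + y | y. y < n \<and> c y n}"
  have lt: "z < k" if "x \<le> n" "z \<in> a x" for x z
    using Suc.prems that unfolding rspan_ok_def by (meson le_imp_less_Suc lessThan_iff subsetD)
  have sh: "c x y" if "x \<le> n" "y \<le> n" "z \<in> a x" "z \<in> a y" for x y z
    using Suc.prems that unfolding rspan_ok_def by (meson disjoint_iff le_imp_less_Suc)
  have refl: "c x x" if "x \<le> n" for x
    using Suc.prems that by (auto simp: rspan_ok_def)
  have sym: "c x y \<longleftrightarrow> c y x" if "x \<le> n" "y \<le> n" for x y
    using Suc.prems that by (auto simp: rspan_ok_def)
  have "rspan_ok (k + n) n c a'"
    unfolding rspan_ok_def
  proof (intro conjI allI impI)
    fix x assume x: "x < n"
    show "c x x" using refl x by simp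
    show "a' x \<subseteq> {..<k + n}" using lt[of x] x by (auto simp: a'_def intro: trans_less_add1)
  next
    fix x y assume xy: "x < n" "y < n"
    show "c x y \<Longrightarrow> c y x" using sym xy by simp
    assume "a' x \<inter> a' y \<noteq> {}"
    then obtain z where "z \<in> a' x" "z \<in> a' y" by blast
    then show "c x y"
      using sh[of x y z] refl[of x] lt[of x z] lt[of y z] xy by (auto simp: a'_def split: if_splits)
  qed
  then have IH: "rexpressible (k + n) n c a'" by (rule Suc.IH)
  have U: "U \<subseteq> {..<k + n}" using lt[of n] by (auto simp: U_def intro: trans_less_add1)
  \<comment> \<open>Meeting \<open>U\<close> in an original wire implies \<open>c x n\<close>
    because the span is valid; the auxiliary wire \<open>k + x\<close> is present just when
    \<open>c x n\<close> holds. Hence adding the event produces exactly \<open>c\<close>.\<close>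
  have meet: "a' x \<inter> U \<noteq> {} \<longleftrightarrow> c x n" if x: "x < n" for x
  proof
    assume "a' x \<inter> U \<noteq> {}"
    then obtain z where "z \<in> a' x" "z \<in> U" by blast
    then show "c x n"
      using sh[of x n z] lt[of x z] lt[of n z] x by (auto simp: a'_def U_def split: if_splits)
  next
    assume "c x n"
    then have "k + x \<in> a' x \<inter> U" using x by (auto simp: a'_def U_def)
    then show "a' x \<inter> U \<noteq> {}" by blast
  qed
  have "rexpressible (k + n) (n + 1) c (\<lambda>x. if x < n then a' x else U)"
  proof (rule rexpressible_cong[OF rexpressible_add_event[OF IH finite_subset[OF U] U]])
    fix x y assume "x < n + 1" "y < n + 1"
    then show "(if x < n \<and> y < n then c x y
        else x = y \<or> x < n \<and> a' x \<inter> U \<noteq> {} \<or> y < n \<and> a' y \<inter> U \<noteq> {}) \<longleftrightarrow> c x y"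
      using meet[of x] meet[of y] sym[of n y] refl[of n]
      by (cases "x = n"; cases "y = n") auto
  qed simp_all
  \<comment> \<open>All auxiliary wires have numbers at least \<open>k\<close>, so closing them
    restores \<open>a\<close>.\<close>
  then have "rexpressible k (n + 1) c (\<lambda>x. (if x < n then a' x else U) \<inter> {..<k})"
    by (rule rexpressible_close_wires)
  then have "rexpressible k (n + 1) c a"
  proof (rule rexpressible_cong)
    fix x assume "x < n + 1"
    then show "(if x < n then a' x else U) \<inter> {..<k} = a x"
      using lt[of x] by (cases "x = n") (auto simp: a'_def U_def split: if_splits)
  qed simp_all
  then show ?case by simp
qed


section \<open>Arbitrary spans\<close>

text \<open>With this apex, the composite of the two factors through \<open>n\<close> is
  \<open>T\<close> itself and not merely isomorphic to it.\<close>

lemma expressible_upto: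
  assumes T: "is_span T" "apex T = cset_upto n c"
  shows "expressible T"
proof -
  let ?a = "lleg T" and ?b = "rleg T" and ?X = "cset_upto n c"
  let ?L = "rspan (src T) n c ?a" and ?R = "rspan (trg T) n c ?b"
  have fin: "fin_cset ?X" and a: "?a \<in> rel_hom ?X (ord (src T))" and b: "?b \<in> rel_hom ?X (ord (trg T))"
    using is_spanD[OF T(1)] T(2) by auto
  have norm: "(\<lambda>x. if x < n then ?a x else {}) = ?a" "(\<lambda>x. if x < n then ?b x else {}) = ?b"
    using rel_homD(4)[OF a] rel_homD(4)[OF b] by (auto simp: cset_upto_def fun_eq_iff)
  have id: "rel_id ?X \<in> rel_hom ?X (ord n)"
    using fin by (intro rel_homI) (auto simp: rel_id_def ord_def discrete_def fin_cset_def
        cset_upto_def split: if_splits)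
  have sp: "is_span ?L" "is_span ?R"
    using fin a b id by (auto simp: is_span_def rspan_sel norm)
  then have "expressible ?L" "expressible (dagger ?R)"
    using rexpressible_rspan_ok unfolding is_span_rspan rexpressible_def biexpressible_def by blast+
  \<comment> \<open>The map \<open>x \<mapsto> {x}\<close> from the apex to the ordinal
    \<open>n\<close> is a monomorphism, so its kernel pair is the apex with identity
    projections.\<close>
  moreover have "is_pullback ?X ?X (ord n) (rel_id ?X) (rel_id ?X) ?X (rel_id ?X) (rel_id ?X)"
  proof -
    have X: "carrier ?X = {..<n}" by (simp add: cset_upto_def)
    have ind: "independent ?X (rel_id ?X y)" if "y \<in> carrier ?X" for y
      using that by (simp add: independent_def rel_id_def)
    have "\<lparr>carrier = carrier ?X, con = {(y, y'). y \<in> carrier ?X \<and> y' \<in> carrier ?X \<and>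
       ((y, y') \<in> con ?X \<or> (\<exists>u\<in>rel_id ?X y. \<exists>u'\<in>rel_id ?X y'. (u, u') \<in> con ?X))}\<rparr> = ?X"
      by (auto simp: cset_upto_def rel_id_def)
    then show ?thesis
      using is_pullback_rel_id[OF X fin fin id ind] by simp
  qed
  ultimately have "expressible (span_comp ?L (dagger ?R) ?X (rel_id ?X) (rel_id ?X))"
    by (intro expressible_comp) (auto simp: rspan_sel)
  moreover have "span_comp ?L (dagger ?R) ?X (rel_id ?X) (rel_id ?X) = T"
    using rel_comp_id(1)[OF a] rel_comp_id(1)[OF b] T(2)
    by (simp add: span_comp_def rspan_sel norm)
  ultimately show ?thesis by simp
qed

lemma span_iso_upto:
  fixes S :: "'a cspan"
  assumes S: "is_span S"
  obtains T n c where "is_span T" "span_iso T S" "apex T = cset_upto n c"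
proof -
  define X where "X = apex S"
  note SD = is_spanD[OF S, folded X_def]
  obtain f where f: "bij_betw f {..<card (carrier X)} (carrier X)"
    using ex_bij_betw_nat_finite[of "carrier X"] SD(1) by (auto simp: fin_cset_def atLeast0LessThan)
  define n where "n = card (carrier X)"
  define c where "c = (\<lambda>i j. (f i, f j) \<in> con X)"
  \<comment> \<open>The value \<open>{}\<close> from \<open>n\<close> on follows the convention for
    morphisms outside their domain.\<close>
  define leg where "leg = (\<lambda>(a :: 'a \<Rightarrow> nat set) i. if i < n then a (f i) else {})"
  define T where "T = \<lparr>src = src S, trg = trg S, apex = cset_upto n c,
    lleg = leg (lleg S), rleg = leg (rleg S)\<rparr>"
  have fX: "f i \<in> carrier X" if "i < n" for i
    using f that by (auto simp: bij_betw_def n_def)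
  have leg: "leg a \<in> rel_hom (cset_upto n c) (ord k)" if "a \<in> rel_hom X (ord k)" for a k
    using rel_homD(1,2)[OF that fX] rel_homD(3)[OF that fX fX]
    by (intro rel_homI) (auto simp: leg_def cset_upto_def c_def split: if_splits)
  have "fin_cset (cset_upto n c)"
    using SD(1) fX by (auto simp: fin_cset_def cset_upto_def c_def)
  then have T: "is_span T"
    using leg SD(2,3) by (simp add: is_span_def T_def)
  have "span_iso T S"
    using f by (intro span_iso_bij_betw[OF T S, of f])
      (auto simp: T_def cset_upto_def c_def leg_def X_def n_def)
  then show thesis using that T by (simp add: T_def)
qed

theorem theorem2:
  fixes k l :: nat and F :: "nat cspan set"
  assumes "F \<in> Sp_hom k l"
  shows "\<exists>e. has_type e k l \<and> sem e = F"
proof -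
  obtain S :: "nat cspan" where S: "F = span_class S" "is_span S" "src S = k" "trg S = l"
    using assms by (auto simp: Sp_hom_def)
  obtain T n c where "is_span T" "span_iso T S" "apex T = cset_upto n c"
    using span_iso_upto[OF S(2)] by blast
  then have "expressible S"
    using expressible_iso expressible_upto S(2) by blast
  then show ?thesis using S by (auto simp: expressible_def)
qed

end
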